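(* Let $a$ and $p$ be integers satisfying $a>p\ge 2$, and let $r=\operatorname{rem}_p(a)$. Then $$G(a,p)=\frac{a^2-(I_p(r)+1)a-(J_p(r)+1)}{p}.$$ In particular, for every fixed $p$, the function $a\mapsto G(a,p)$ on integers $a>p$ is a quadratic quasi-polynomial with period dividing $p$.
   Context: $\mathbb{N}$ denotes the non-negative integers. For $a\ge 2$, $\langle a,a+1\rangle=\{xa+y(a+1):x,y\in\mathbb{N}\}$. For $S\subseteq\mathbb{N}$ a numerical semigroup (contains $0$, closed under addition, finite complement) and a positive integer $p$, $\frac{S}{p}=\{n\in\mathbb{N}:pn\in S\}$; for $S\ne\mathbb{N}$ the Frobenius number is $g(S)=\max(\mathbb{N}\setminus S)$. Set $G(a,p)=g\!\left(\frac{\langle a,a+1\rangle}{p}\right)$. For an integer $u$, $\operatorname{rem}_p(u)$ is the unique integer in $\{0,1,\ldots,p-1\}$ congruent to $u$ modulo $p$. For $r,i\in\{0,1,\ldots,p-1\}$ define $\delta_{p,r}(i)=\operatorname{rem}_p(r^2-r-1-ir)$, and $$I_p(r)=\min\{i\in\{0,\ldots,p-1\}:\delta_{p,r}(i)\le i\},\qquad J_p(r)=\delta_{p,r}(I_p(r)).$$ (The set in the minimum is nonempty, as it contains $p-1$.) A function $h$ is a quasi-polynomial of period $p$ on a specified range of integers if there exist polynomials $Q_0,\ldots,Q_{p-1}\in\mathbb{C}[X]$ such that $h(n)=Q_r(n)$ whenever $n\equiv r\pmod p$ throughout that range (the actual minimal period may be a proper divisor of $p$); it is quadratic if these polynomials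 have degree $2$. *)

theory Defs
  imports Complex_Main "HOL-Computational_Algebra.Polynomial"
begin

definition numerical_semigroup :: "nat set \<Rightarrow> bool" where
  "numerical_semigroup S \<longleftrightarrow>
     0 \<in> S \<and> (\<forall>x\<in>S. \<forall>y\<in>S. x + y \<in> S) \<and> finite (UNIV - S)"

definition consec_semigroup :: "nat \<Rightarrow> nat set" where
  "consec_semigroup a = {x * a + y * (a + 1) | x y. True}"

definition semigroup_quotient :: "nat set \<Rightarrow> nat \<Rightarrow> nat set" where
  "semigroup_quotient S p = {n. p * n \<in> S}"

text \<open>Meaningful only for a numerical semigroup other than \<open>UNIV\<close>: then the set of gaps
  is finite and nonempty. The two lemmas below show that this is the case wherever the
  Frobenius number is used.\<close>

definition frobenius_number :: "nat set \<Rightarrow> nat" where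
  "frobenius_number S = Max (UNIV - S)"

definition G :: "nat \<Rightarrow> nat \<Rightarrow> nat" where
  "G a p = frobenius_number (semigroup_quotient (consec_semigroup a) p)"

lemma numerical_semigroup_quotient_consec:
  assumes "0 < a" and "0 < p"
  shows "numerical_semigroup (semigroup_quotient (consec_semigroup a) p)"
proof -
  have add: "x + y \<in> consec_semigroup a"
    if x: "x \<in> consec_semigroup a" and y: "y \<in> consec_semigroup a" for x y
  proof -
    obtain k l k' l' where "x = k * a + l * (a + 1)" "y = k' * a + l' * (a + 1)"
      using x y unfolding consec_semigroup_def by blast
    then have "x + y = (k + k') * a + (l + l') * (a + 1)"
      by (simp add: algebra_simps)
    then show ?thesis
      unfolding consec_semigroup_def by blast
  qed
  have zero: "0 \<in> consec_semigroup a"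
    unfolding consec_semigroup_def by auto
  have big: "n \<in> consec_semigroup a" if "a * a \<le> n" for n
  proof -
    have "a \<le> n div a"
      using that assms(1) by (simp add: less_eq_div_iff_mult_less_eq)
    moreover have "n mod a < a"
      using assms(1) by simp
    ultimately obtain k where k: "n div a = k + n mod a"
      by (metis add.commute le_Suc_ex less_imp_le order_trans)
    have "n = (n div a) * a + n mod a"
      by simp
    also have "\<dots> = k * a + (n mod a) * (a + 1)"
      by (subst k) (simp add: algebra_simps)
    finally show ?thesis
      unfolding consec_semigroup_def by blast
  qed
  have "n < a * a" if "p * n \<notin> consec_semigroup a" for n
  proof (rule ccontr)
    assume "\<not> n < a * a"
    moreover have "n \<le> p * n"
      using assms(2) by simp
    ultimately have "a * a \<le> p * n"
      by linarith
    with big that show False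
      by blast
  qed
  then have "UNIV - semigroup_quotient (consec_semigroup a) p \<subseteq> {..<a * a}"
    unfolding semigroup_quotient_def by auto
  then have "finite (UNIV - semigroup_quotient (consec_semigroup a) p)"
    using finite_subset by blast
  with add zero show ?thesis
    unfolding numerical_semigroup_def semigroup_quotient_def
    by (simp add: distrib_left)
qed

lemma semigroup_quotient_consec_neq_UNIV:
  assumes "0 < p" and "p < a"
  shows "semigroup_quotient (consec_semigroup a) p \<noteq> UNIV"
proof -
  have "p \<noteq> x * a + y * (a + 1)" for x y
    using assms by (cases x; cases y) auto
  then have "1 \<notin> semigroup_quotient (consec_semigroup a) p"
    unfolding semigroup_quotient_def consec_semigroup_def by auto
  then show ?thesis
    by blast
qed

definition rem_p :: "nat \<Rightarrow> int \<Rightarrow> nat" where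
  "rem_p p u = nat (u mod int p)"

definition delta_p :: "nat \<Rightarrow> nat \<Rightarrow> nat \<Rightarrow> nat" where
  "delta_p p r i = rem_p p ((int r)\<^sup>2 - int r - 1 - int i * int r)"

definition I_p :: "nat \<Rightarrow> nat \<Rightarrow> nat" where
  "I_p p r = Min {i \<in> {0..p - 1}. delta_p p r i \<le> i}"

definition J_p :: "nat \<Rightarrow> nat \<Rightarrow> nat" where
  "J_p p r = delta_p p r (I_p p r)"

text \<open>Having period \<open>d\<close> does not mean that \<open>d\<close> is the smallest period; the smallest one is
  \<open>minimal_period\<close>. The ranges considered contain only non-negative integers.\<close>

definition quasi_polynomial_on :: "nat set \<Rightarrow> nat \<Rightarrow> (nat \<Rightarrow> complex) \<Rightarrow> bool" where
  "quasi_polynomial_on A d h \<longleftrightarrow>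
     (\<exists>Q :: nat \<Rightarrow> complex poly. \<forall>r<d. \<forall>n\<in>A. n mod d = r \<longrightarrow> h n = poly (Q r) (of_nat n))"

definition quadratic_quasi_polynomial_on :: "nat set \<Rightarrow> nat \<Rightarrow> (nat \<Rightarrow> complex) \<Rightarrow> bool" where
  "quadratic_quasi_polynomial_on A d h \<longleftrightarrow>
     (\<exists>Q :: nat \<Rightarrow> complex poly. \<forall>r<d. degree (Q r) = 2 \<and>
        (\<forall>n\<in>A. n mod d = r \<longrightarrow> h n = poly (Q r) (of_nat n)))"

definition minimal_period :: "nat set \<Rightarrow> (nat \<Rightarrow> complex) \<Rightarrow> nat" where
  "minimal_period A h = (LEAST d. 0 < d \<and> quasi_polynomial_on A d h)"

end

theory Submission
  imports Defs "HOL-Number_Theory.Cong"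
begin

text \<open>With quotient \<open>q\<close> and remainder \<open>s\<close> modulo \<open>a\<close>, a number lies in \<open>\<langle>a, a + 1\<rangle>\<close> iff \<open>s \<le> q\<close>.
  Counting down from \<open>a\<^sup>2\<close>, put \<open>i = a - 2 - q\<close> and \<open>j = a - 1 - s\<close>: the number is
  \<open>a\<^sup>2 - (i + 1) a - (j + 1)\<close>, it is a gap iff \<open>j \<le> i\<close>, and it is divisible by \<open>p\<close> iff
  \<open>j \<equiv> \<delta>(i)\<close> modulo \<open>p\<close>. The largest gap divisible by \<open>p\<close> therefore has the least \<open>i\<close> with
  \<open>\<delta>(i) \<le> i\<close>, and then \<open>j = \<delta>(i)\<close>.

  For the minimal period: if a function has periods \<open>d\<close> and \<open>p\<close> as a quasi-polynomial, then by the
  Chinese remainder theorem the polynomials attached to residues that agree modulo \<open>gcd d p\<close>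
  coincide at infinitely many points, so \<open>gcd d p\<close> is a period as well.\<close>

section \<open>Membership in \<open>consec_semigroup a\<close> and residues modulo
  \<open>p\<close>\<close>

lemma mem_consec_semigroup_iff:
  assumes "0 < a"
  shows "n \<in> consec_semigroup a \<longleftrightarrow> n mod a \<le> n div a"
proof
  assume "n \<in> consec_semigroup a"
  then obtain x y where n: "n = x * a + y * (a + 1)"
    unfolding consec_semigroup_def by blast
  \<comment> \<open>Here \<open>y\<close> is a provisional remainder and \<open>x + y\<close> a
    provisional quotient; reducing \<open>y\<close> modulo \<open>a\<close> can only lower the
    former and raise the latter.\<close>
  have n': "n = y + (x + y) * a"
    using n by (simp add: algebra_simps)
  have "n div a = y div a + (x + y)" "n mod a = y mod a"
    using assms unfolding n' by simp_all
  then show "n mod a \<le> n div a"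
    using mod_less_eq_dividend[of y a] by linarith
next
  assume "n mod a \<le> n div a"
  then obtain k where k: "n div a = n mod a + k"
    using le_Suc_ex by blast
  have "n = (n div a) * a + n mod a"
    by simp
  also have "\<dots> = k * a + (n mod a) * (a + 1)"
    by (subst k) (simp add: algebra_simps)
  finally show "n \<in> consec_semigroup a"
    unfolding consec_semigroup_def by blast
qed

lemma rem_p_of_nat: "rem_p p (int a) = a mod p"
  unfolding rem_p_def by (metis nat_int of_nat_mod)

lemma int_delta_p:
  assumes "0 < p"
  shows "int (delta_p p r i) = ((int r)\<^sup>2 - int r - 1 - int i * int r) mod int p"
  using assms unfolding delta_p_def rem_p_def by simp

lemma delta_p_less: "0 < p \<Longrightarrow> delta_p p r i < p"
  unfolding delta_p_def rem_p_def by (simp add: nat_less_iff)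

lemma dvd_iff_cong_delta_p:
  assumes "0 < p" and "r = a mod p"
  shows "int p dvd (int a)\<^sup>2 - (int i + 1) * int a - (int j + 1)
    \<longleftrightarrow> [int j = int (delta_p p r i)] (mod int p)"
proof -
  have a: "[int r = int a] (mod int p)"
    using assms by (simp add: cong_def of_nat_mod)
  have "[int (delta_p p r i) = (int r)\<^sup>2 - int r - 1 - int i * int r] (mod int p)"
    using int_delta_p[OF assms(1)] by (simp add: cong_def)
  also have "[(int r)\<^sup>2 - int r - 1 - int i * int r
      = (int a)\<^sup>2 - int a - 1 - int i * int a] (mod int p)"
    by (intro cong_diff cong_mult cong_pow cong_refl a)
  finally have d: "[int (delta_p p r i) = (int a)\<^sup>2 - int a - 1 - int i * int a] (mod int p)" .
  have "[int j = int (delta_p p r i)] (mod int p)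
      \<longleftrightarrow> [(int a)\<^sup>2 - int a - 1 - int i * int a = int j] (mod int p)"
    using d by (meson cong_sym cong_trans)
  also have "\<dots> \<longleftrightarrow> int p dvd (int a)\<^sup>2 - (int i + 1) * int a - (int j + 1)"
    by (simp add: cong_iff_dvd_diff algebra_simps)
  finally show ?thesis ..
qed

text \<open>The minimum exists because residues are at most \<open>p - 1\<close>. The last claim
  does not bound \<open>i\<close>, as the index of a gap can reach \<open>a - 2\<close>; for
  \<open>i \<ge> p\<close> it follows from \<open>I_p p r < p\<close>.\<close>

lemma I_p_props:
  assumes "0 < p"
  shows "I_p p r < p" and "J_p p r \<le> I_p p r"
    and "delta_p p r i \<le> i \<Longrightarrow> I_p p r \<le> i"
proof -
  let ?A = "{i \<in> {0..p - 1}. delta_p p r i \<le> i}"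
  have fin: "finite ?A" by simp
  have "p - 1 \<in> ?A"
    using delta_p_less[OF assms, of r "p - 1"] by simp
  then have "I_p p r \<in> ?A"
    unfolding I_p_def by (intro Min_in fin) auto
  then show lt: "I_p p r < p" and "J_p p r \<le> I_p p r"
    using assms by (auto simp: J_p_def)
  show "I_p p r \<le> i" if "delta_p p r i \<le> i"
  proof (cases "i \<le> p - 1")
    case True
    then show ?thesis
      using that unfolding I_p_def by (intro Min_le fin) auto
  next
    case False
    then show ?thesis using lt by linarith
  qed
qed

section \<open>The Frobenius number of the quotient\<close>

lemma p_times_G:
  assumes "0 < p" and "p < a" and r: "r = a mod p"
  shows "int p * int (G a p)
    = (int a)\<^sup>2 - (int (I_p p r) + 1) * int a - (int (J_p p r) + 1)"
proof -
  let ?I = "I_p p r" and ?J = "J_p p r"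
  let ?S = "semigroup_quotient (consec_semigroup a) p"
  let ?F = "(int a)\<^sup>2 - (int ?I + 1) * int a - (int ?J + 1)"
  have a0: "0 < a" using assms by simp
  note I = I_p_props[OF assms(1), of r]
  have fin: "finite (UNIV - ?S)"
    using numerical_semigroup_quotient_consec[OF a0 assms(1)]
    unfolding numerical_semigroup_def by blast
  \<comment> \<open>Since \<open>?J \<le> ?I \<le> p - 1 \<le> a - 2\<close>, neither subtraction
    truncates.\<close>
  define q where "q = a - 2 - ?I"
  define s where "s = a - 1 - ?J"
  have q: "int q = int a - 2 - int ?I" and s: "int s = int a - 1 - int ?J"
    using I(1,2) assms(2) unfolding q_def s_def by linarith+
  have F: "?F = int (q * a + s)"
    by (simp add: q s algebra_simps power2_eq_square)
  have "int p dvd ?F"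
    unfolding dvd_iff_cong_delta_p[OF assms(1) r] J_p_def by simp
  then have "p dvd q * a + s"
    unfolding F by (simp only: int_dvd_int_iff)
  then obtain n where n: "q * a + s = p * n" ..
  have "s < a"
    using s a0 by linarith
  then have "(p * n) div a = q" "(p * n) mod a = s"
    unfolding n[symmetric] by simp_all
  then have gap: "n \<in> UNIV - ?S"
    using I(2) q s by (simp add: semigroup_quotient_def mem_consec_semigroup_iff[OF a0])
  have max: "m \<le> n" if "m \<in> UNIV - ?S" for m
  proof -
    define q' where "q' = (p * m) div a"
    define s' where "s' = (p * m) mod a"
    have m: "p * m = q' * a + s'"
      unfolding q'_def s'_def by simp
    have "q' < s'"
      using that by (simp add: semigroup_quotient_def mem_consec_semigroup_iff[OF a0] q'_def s'_def)
    have "s' < a"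
      unfolding s'_def using a0 by simp
    \<comment> \<open>From \<open>q' < s' < a\<close> follows \<open>q' \<le> a - 2\<close>, so
      nothing truncates here either.\<close>
    define i where "i = a - 2 - q'"
    define j where "j = a - 1 - s'"
    have i: "int q' = int a - 2 - int i" and j: "int s' = int a - 1 - int j"
      using \<open>q' < s'\<close> \<open>s' < a\<close> unfolding i_def j_def by linarith+
    have "j \<le> i" "j < a"
      using i j \<open>q' < s'\<close> by linarith+
    have F': "int (p * m) = (int a)\<^sup>2 - (int i + 1) * int a - (int j + 1)"
      unfolding m by (simp add: i j algebra_simps power2_eq_square)
    have "int p dvd int (p * m)"
      by simp
    then have "[int j = int (delta_p p r i)] (mod int p)"
      unfolding F' dvd_iff_cong_delta_p[OF assms(1) r] .
    \<comment> \<open>\<open>j\<close> may exceed \<open>p\<close>, so only its residue is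
      determined; \<open>delta_p p r i \<le> j \<le> i\<close> is still enough for the minimality of
      \<open>?I\<close>.\<close>
    then have "delta_p p r i = j mod p"
      using delta_p_less[OF assms(1), of r i] by (simp add: cong_def flip: of_nat_mod)
    then have dj: "delta_p p r i \<le> j"
      by simp
    then have "?I \<le> i"
      using I(3) \<open>j \<le> i\<close> by (meson le_trans)
    \<comment> \<open>Lexicographic comparison: a larger \<open>i\<close> means a smaller quotient,
      which outweighs any remainder below \<open>a\<close>; for equal \<open>i\<close> the
      remainders decide.\<close>
    have "q' * a + s' \<le> q * a + s"
    proof (cases "i = ?I")
      case True
      then have "?J \<le> j"
        using dj by (simp add: J_p_def)
      then have "q' = q" "s' \<le> s"
        using True i j q s by linarith+
      then show ?thesis by simp
    next
      case False
      then have "Suc q' \<le> q"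
        using \<open>?I \<le> i\<close> i q by linarith
      then have "Suc q' * a \<le> q * a"
        by (rule mult_le_mono1)
      then show ?thesis
        using \<open>s' < a\<close> by simp
    qed
    then show ?thesis
      using assms(1) unfolding m[symmetric] n by simp
  qed
  have "G a p = n"
    unfolding G_def frobenius_number_def using gap max fin by (intro Max_eqI)
  then show ?thesis
    using F n by simp
qed

text \<open>Cleared of its denominator, the formula passes to any ring; it serves both the real and
  the complex numbers.\<close>

lemma of_nat_p_times_G:
  assumes "0 < p" and "p < a"
  shows "of_nat p * of_nat (G a p) =
    ((of_nat a)\<^sup>2 - (of_nat (I_p p (a mod p)) + 1) * of_nat a
      - (of_nat (J_p p (a mod p)) + 1) :: 'a :: ring_1)"
  using arg_cong[OF p_times_G[OF assms refl], of "of_int :: int \<Rightarrow> 'a"] by simp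

section \<open>Quasi-polynomials and their minimal period\<close>

lemma poly_eqI_infinite:
  fixes P Q :: "'a :: idom poly"
  assumes "infinite A" and "\<And>x. x \<in> A \<Longrightarrow> poly P x = poly Q x"
  shows "P = Q"
proof (rule ccontr)
  assume "P \<noteq> Q"
  then have "finite {x. poly (P - Q) x = 0}"
    by (intro poly_roots_finite) simp
  moreover have "A \<subseteq> {x. poly (P - Q) x = 0}"
    using assms(2) by auto
  ultimately show False
    using assms(1) finite_subset by blast
qed

text \<open>The two congruences are compatible because \<open>n\<close> and \<open>c\<close> agree
  modulo \<open>gcd d p\<close>. Starting at \<open>m \<ge> n\<close> keeps the progression in every
  range \<open>{a. b < a}\<close> that contains \<open>n\<close>.\<close>

lemma common_progression:
  fixes c d n p :: nat
  assumes "0 < d" and "0 < p" and "c = n mod gcd d p"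
  obtains m where "n \<le> m" and "\<And>u. (m + u * (p * d)) mod d = n mod d"
    and "\<And>u. (m + u * (p * d)) mod p = c mod p"
proof -
  let ?g = "gcd d p"
  obtain x y where xy: "d * x = p * y + ?g"
    using bezout_nat[of d p] assms(1) by auto
  define k where "k = n div ?g"
  have n: "n = c + k * ?g"
    unfolding k_def assms(3) by (rule mod_div_mult_eq[symmetric])
  \<comment> \<open>As \<open>d * x\<close> is congruent to \<open>?g\<close> modulo
    \<open>p\<close>, the integer \<open>n - k * x * d\<close> lies in the class of
    \<open>c\<close>; adding \<open>k * x * d * p\<close> keeps both classes and avoids negative
    numbers.\<close>
  define m where "m = n + k * x * (p - 1) * d"
  have "m + k * x * d = n + k * x * d * p"
    unfolding m_def using assms(2) by (cases p) (simp_all add: algebra_simps)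
  moreover have "m + k * x * d = m + k * ?g + k * y * p"
    using xy by (metis add.commute add.assoc distrib_left mult.assoc mult.commute)
  ultimately have "m + k * ?g + k * y * p = c + k * ?g + k * x * d * p"
    using n by (metis (no_types))
  then have "[m + k * ?g = c + k * ?g] (mod p)"
    unfolding cong_def by (metis mod_mult_self1)
  then have "[m = c] (mod p)"
    by (simp only: cong_add_rcancel_nat)
  then have mp: "(m + u * (p * d)) mod p = c mod p" for u
    by (simp add: cong_def mult.left_commute[of u p d])
  have md: "(m + u * (p * d)) mod d = n mod d" for u
  proof -
    have "m + u * (p * d) = n + (k * x * (p - 1) + u * p) * d"
      unfolding m_def by (simp add: algebra_simps)
    then show ?thesis by simp
  qed
  show ?thesis
    by (rule that[OF _ md mp]) (simp add: m_def)
qed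

lemma quasi_polynomial_on_gcd:
  assumes "quasi_polynomial_on {a. b < a} d h" and "quasi_polynomial_on {a. b < a} p h"
    and "0 < d" and "0 < p"
  shows "quasi_polynomial_on {a. b < a} (gcd d p) h"
proof -
  obtain Q where Q: "h n = poly (Q (n mod d)) (of_nat n)" if "b < n" for n
    using assms(1,3) unfolding quasi_polynomial_on_def by (metis mem_Collect_eq mod_less_divisor)
  obtain R where R: "h n = poly (R (n mod p)) (of_nat n)" if "b < n" for n
    using assms(2,4) unfolding quasi_polynomial_on_def by (metis mem_Collect_eq mod_less_divisor)
  \<comment> \<open>The polynomial \<open>R\<close> of the representative
    \<open>n mod gcd d p\<close> serves the whole class: on the common progression it agrees with
    \<open>Q (n mod d)\<close>, which gives \<open>h n\<close>.\<close>
  have "h n = poly (R ((n mod gcd d p) mod p)) (of_nat n)" if n: "b < n" for n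
  proof -
    obtain m where m: "n \<le> m" "\<And>u. (m + u * (p * d)) mod d = n mod d"
        "\<And>u. (m + u * (p * d)) mod p = (n mod gcd d p) mod p"
      using common_progression[OF assms(3,4) refl] by blast
    have "inj (\<lambda>u. of_nat (m + u * (p * d)) :: complex)"
      using assms(3,4) by (intro injI) (simp only: of_nat_eq_iff, simp)
    then have "infinite (range (\<lambda>u. of_nat (m + u * (p * d)) :: complex))"
      using finite_imageD infinite_UNIV_nat by blast
    then have "R ((n mod gcd d p) mod p) = Q (n mod d)"
    proof (rule poly_eqI_infinite)
      fix z :: complex
      assume "z \<in> range (\<lambda>u. of_nat (m + u * (p * d)))"
      then obtain u where z: "z = of_nat (m + u * (p * d))" by blast
      have "b < m + u * (p * d)"
        using m(1) n by simp
      from Q[OF this] R[OF this] show "poly (R ((n mod gcd d p) mod p)) z = poly (Q (n mod d)) z"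
        unfolding m(2,3) z by simp
    qed
    then show ?thesis
      using Q[OF n] by simp
  qed
  then show ?thesis
    unfolding quasi_polynomial_on_def by (intro exI[of _ "\<lambda>c. R (c mod p)"]) auto
qed

text \<open>The gcd of the minimal period \<open>d\<close> and \<open>p\<close> is again a period
  and at most \<open>d\<close>, so it equals \<open>d\<close>.\<close>

lemma minimal_period_dvd:
  assumes "quasi_polynomial_on {a. b < a} p h" and "0 < p"
  shows "minimal_period {a. b < a} h dvd p"
proof -
  define d where "d = minimal_period {a. b < a} h"
  have d: "0 < d \<and> quasi_polynomial_on {a. b < a} d h"
    unfolding d_def minimal_period_def by (rule LeastI[of _ p]) (use assms in simp)
  then have "0 < gcd d p \<and> quasi_polynomial_on {a. b < a} (gcd d p) h"
    using quasi_polynomial_on_gcd assms by simp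
  then have "d \<le> gcd d p"
    unfolding d_def minimal_period_def by (rule Least_le)
  then have "gcd d p = d"
    using d by (meson dvd_imp_le gcd_dvd1 le_antisym)
  then show ?thesis
    unfolding d_def by (metis gcd_dvd2)
qed

theorem theorem1p4:
  fixes p :: nat
  assumes "2 \<le> p"
  shows "(\<forall>a>p. \<forall>r. r = rem_p p (int a) \<longrightarrow>
            real (G a p) =
              ((real a)\<^sup>2 - (real (I_p p r) + 1) * real a - (real (J_p p r) + 1)) / real p)
       \<and> quadratic_quasi_polynomial_on {a. p < a} p (\<lambda>a. of_nat (G a p))
       \<and> minimal_period {a. p < a} (\<lambda>a. of_nat (G a p)) dvd p"
proof -
  have p: "0 < p" using assms by simp
  have formula: "real (G a p) =
      ((real a)\<^sup>2 - (real (I_p p r) + 1) * real a - (real (J_p p r) + 1)) / real p"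
    if "p < a" "r = rem_p p (int a)" for a r
    using of_nat_p_times_G[OF p that(1), where 'a = real] that(2) p by (simp add: rem_p_of_nat field_simps)
  define Q :: "nat \<Rightarrow> complex poly" where
    "Q r = smult (1 / of_nat p) [:- (of_nat (J_p p r) + 1), - (of_nat (I_p p r) + 1), 1:]" for r
  \<comment> \<open>The leading coefficient is \<open>1 / of_nat p\<close>, nonzero for every
    residue.\<close>
  have deg: "degree (Q r) = 2" for r
    unfolding Q_def using p by simp
  have poly_Q: "poly (Q r) x =
      (x\<^sup>2 - (of_nat (I_p p r) + 1) * x - (of_nat (J_p p r) + 1)) / of_nat p" for r x
    by (simp add: Q_def algebra_simps power2_eq_square diff_divide_distrib add_divide_distrib)
  have Q: "of_nat (G a p) = poly (Q (a mod p)) (of_nat a)" if "p < a" for a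
    unfolding poly_Q of_nat_p_times_G[OF p that, symmetric] using p by simp
  have "quadratic_quasi_polynomial_on {a. p < a} p (\<lambda>a. of_nat (G a p))"
    unfolding quadratic_quasi_polynomial_on_def using deg Q by (intro exI[of _ Q]) auto
  moreover have "quasi_polynomial_on {a. p < a} p (\<lambda>a. of_nat (G a p))"
    unfolding quasi_polynomial_on_def using Q by (intro exI[of _ Q]) auto
  then have "minimal_period {a. p < a} (\<lambda>a. of_nat (G a p)) dvd p"
    using minimal_period_dvd p by blast
  ultimately show ?thesis
    using formula by blast
qed

end
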